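(* Let $m=(k,1,2)$ with $k\ge1$ an integer. Then the $m$-Minkowski functional $\mathfrak h_{\mathcal P}$ of the pentablock $\mathcal P\subset\mathbb C^3$ is continuous. In particular, $\mathcal P$ is hyperconvex.
   Context: Let $\mathbb D$ be the open unit disc in $\mathbb C$ and let $\mathbb G_2=\{(s,p)\in\mathbb C^2:1-sz+pz^2\neq0\text{ for all }z\in\overline{\mathbb D}\}=\{(\lambda_1+\lambda_2,\lambda_1\lambda_2):\lambda_1,\lambda_2\in\mathbb D\}$ be the symmetrized bidisc. The pentablock is $$\mathcal P=\left\{(a,s,p)\in\mathbb C^3:(s,p)\in\mathbb G_2,\ |a|<\left|1-\frac{\frac12s\overline{\beta}}{1+\sqrt{1-|\beta|^2}}\right|\right\},\qquad \beta=\beta(s,p)=\frac{s-\overline{s}p}{1-|p|^2}.$$ For $m\in\mathbb N^d$, $\lambda\in\mathbb C$, $z\in\mathbb C^d$ put $m_\lambda.z=(\lambda^{m_1}z_1,\dots,\lambda^{m_d}z_d)$. A domain $D\subset\mathbb C^d$ is $m$-balanced if $m_\lambda.z\in D$ whenever $z\in D$, $\lambda\in\overline{\mathbb D}$; its $m$-Minkowski functional is $\mathfrak h_D(x)=\inf\{\lambda>0:m_{1/\lambda}.x\in D\}$, $x\in\mathbb C^d$. (The pentablock is a $(k,1,2)$-balanced domain for every $k\ge0$.) A bounded domain $D$ is hyperconvex if it has a continuous negative plurisubharmonic exhaustion function $u$ (i.e. $\{u<c\}$ is relatively compact in $D$ for every $c<0$). *)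

theory Defs
  imports "HOL-Analysis.Analysis"
begin

definition sym_bidisc :: "(complex \<times> complex) set" where
  "sym_bidisc = {(s, p). \<forall>z\<in>cball 0 1. 1 - s * z + p * z^2 \<noteq> 0}"

definition penta_beta :: "complex \<Rightarrow> complex \<Rightarrow> complex" where
  "penta_beta s p = (s - cnj s * p) / of_real (1 - (cmod p)^2)"

text \<open>For \<open>(s, p)\<close> in the symmetrized bidisc one has \<open>\<bar>p\<bar> < 1\<close> and \<open>\<bar>\<beta>\<bar> < 1\<close>, so the
  division above and the real square root below take no junk values.\<close>

definition pentablock :: "(complex ^ 3) set" where
  "pentablock = {vector [a, s, p] | a s p. (s, p) \<in> sym_bidisc \<and>
     cmod a < cmod (1 - (1/2 * s * cnj (penta_beta s p)) /
                        of_real (1 + sqrt (1 - (cmod (penta_beta s p))^2)))}"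

definition m_action :: "nat ^ 'd \<Rightarrow> complex \<Rightarrow> complex ^ 'd \<Rightarrow> complex ^ 'd" where
  "m_action m c z = (\<chi> i. c ^ (m $ i) * z $ i)"

text \<open>The infimum is taken in \<open>real\<close>. Its index set is nonempty for every \<open>x\<close> as soon as all
  weights are at least 1 and \<open>D\<close> is a neighbourhood of 0; outside that situation
  the value may be the junk value \<open>Inf {}\<close> instead of \<open>\<infinity>\<close>.\<close>

definition m_minkowski :: "nat ^ 'd \<Rightarrow> (complex ^ 'd) set \<Rightarrow> complex ^ 'd \<Rightarrow> real" where
  "m_minkowski m D x = Inf {t::real. t > 0 \<and> m_action m (of_real (1 / t)) x \<in> D}"

definition usc_on :: "'a::topological_space set \<Rightarrow> ('a \<Rightarrow> ereal) \<Rightarrow> bool" where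
  "usc_on D u \<longleftrightarrow> (\<forall>z\<in>D. \<forall>c>u z. \<forall>\<^sub>F w in at z within D. u w < c)"

text \<open>Lebesgue integral of an extended-real function; \<open>e2ennreal\<close> sends negative values to 0, so
  the two terms are the integrals of the positive and the negative part. It is meaningful
  when one of them is finite, which holds below since an upper semicontinuous function
  with values \<open>< \<infinity>\<close> is bounded above on a circle.\<close>

definition ext_integral :: "'a measure \<Rightarrow> ('a \<Rightarrow> ereal) \<Rightarrow> ereal" where
  "ext_integral M f =
     enn2ereal (\<integral>\<^sup>+ x. e2ennreal (f x) \<partial>M) - enn2ereal (\<integral>\<^sup>+ x. e2ennreal (- f x) \<partial>M)"

definition circle_mean :: "(complex \<Rightarrow> ereal) \<Rightarrow> complex \<Rightarrow> real \<Rightarrow> ereal" where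
  "circle_mean v c r =
     ereal (1 / (2 * pi)) * ext_integral (lebesgue_on {0..2*pi}) (\<lambda>t. v (c + of_real r * cis t))"

text \<open>Values are in \<open>[-\<infinity>, \<infinity>)\<close>; the function that is identically \<open>-\<infinity>\<close> is admitted.\<close>

definition subharmonic_on :: "complex set \<Rightarrow> (complex \<Rightarrow> ereal) \<Rightarrow> bool" where
  "subharmonic_on U v \<longleftrightarrow> (\<forall>z\<in>U. v z < \<infinity>) \<and> usc_on U v \<and>
     (\<forall>c r. r > 0 \<longrightarrow> cball c r \<subseteq> U \<longrightarrow> v c \<le> circle_mean v c r)"

definition plurisubharmonic_on :: "(complex ^ 'd) set \<Rightarrow> (complex ^ 'd \<Rightarrow> ereal) \<Rightarrow> bool" where
  "plurisubharmonic_on D u \<longleftrightarrow> (\<forall>z\<in>D. u z < \<infinity>) \<and> usc_on D u \<and>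
     (\<forall>a b. subharmonic_on {w. a + w *s b \<in> D} (\<lambda>w. u (a + w *s b)))"

definition hyperconvex :: "(complex ^ 'd) set \<Rightarrow> bool" where
  "hyperconvex D \<longleftrightarrow> D \<noteq> {} \<and> open D \<and> connected D \<and> bounded D \<and>
     (\<exists>u :: complex ^ 'd \<Rightarrow> real.
        continuous_on D u \<and> (\<forall>z\<in>D. u z < 0) \<and>
        plurisubharmonic_on D (\<lambda>z. ereal (u z)) \<and>
        (\<forall>c<0. compact (closure {z\<in>D. u z < c}) \<and> closure {z\<in>D. u z < c} \<subseteq> D))"

end

theory Submission
  imports Defs "HOL-Complex_Analysis.Cauchy_Integral_Formula"
begin

text \<open>
  Everything rests on a description of the pentablock by one family of inequalities: a point
  \<open>(a, s, p)\<close> belongs to it iff \<open>\<bar>a\<bar> (1 - \<bar>z\<bar>\<^sup>2) < \<bar>1 - s z + p z\<^sup>2\<bar>\<close> for all \<open>z\<close> in the closed disc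
  (\<open>pentablock_iff\<close>). The inequalities say that the polynomial on the right has no zero in
  the closed disc, and that \<open>a\<close> is small. For the proof one shows that the radius in the definition of the pentablock
  is the minimum of \<open>\<bar>1 - s z + p z\<^sup>2\<bar> / (1 - \<bar>z\<bar>\<^sup>2)\<close> over the open disc. The minimum is attained at
  \<open>\<zeta> = cnj \<beta> / (1 + sqrt (1 - \<bar>\<beta>\<bar>\<^sup>2))\<close>, and up to the factor \<open>(1 - cnj \<zeta> * z)\<^sup>2\<close> the
  substitution \<open>w = (z - \<zeta>) / (1 - cnj \<zeta> * z)\<close> turns the quadratic polynomial into some \<open>A + B w\<^sup>2\<close> with
  \<open>\<bar>B\<bar> \<le> \<bar>A\<bar>\<close>, for which minimality at \<open>w = 0\<close> is evident.

  Continuity of the Minkowski functional \<open>h\<close>: for \<open>r > 0\<close> the set \<open>{h < r}\<close> is the preimage of the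
  balanced domain under the dilation by \<open>1 / r\<close>, hence open. If moreover every proper contraction maps the
  closure of the domain into the domain, then \<open>{h \<le> r}\<close> is the preimage of the closure, hence closed
  (\<open>continuous_on_m_minkowski\<close>). For the pentablock the contraction property follows from the
  inequalities above (\<open>pentablock_shrink\<close>); when \<open>a = 0\<close> they carry no information on the closure,
  and the bound \<open>(1 - \<bar>z\<bar>)\<^sup>2 \<le> \<bar>1 - s z + p z\<^sup>2\<bar>\<close>, which also survives limits, takes over.

  Hyperconvexity: instead of the logarithm of \<open>h\<close>, the exhaustion function is a supremum of moduli of
  two families of holomorphic functions, minus 1, namely of
  \<open>Psi z = a (1 - \<bar>z\<bar>\<^sup>2) / (1 - s z + p z\<^sup>2)\<close> and of \<open>Phi z = (2 z p - s) / (2 - z s)\<close>, where \<open>z\<close> runs through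
  the closed disc. Both suprema are below 1 on the pentablock, by the description above and by
  \<open>Phi_less_1\<close>; since \<open>z\<close> ranges over a compact set, they are attained and continuous, and they satisfy
  the sub-mean value inequality because each modulus does (\<open>subharmonic_onI_support\<close>). A uniform bound
  \<open>\<bar>Phi z\<bar> \<le> t < 1\<close> keeps \<open>(s, p)\<close> inside the symmetrized bidisc in the limit
  (\<open>sym_bidisc_if_Phi_le\<close>), and then the bound on \<open>Psi z\<close> keeps \<open>(a, s, p)\<close> inside the pentablock. So
  the sublevel sets are relatively compact.
\<close>

section \<open>Suprema of moduli of holomorphic functions\<close>

text \<open>By compactness of the parameter set the functions \<open>f x\<close> vary uniformly with \<open>x\<close>, and nearby
  functions have nearby suprema.\<close>

lemma continuous_on_SUP_compact:
  fixes f :: "'a::topological_space \<Rightarrow> 'b::topological_space \<Rightarrow> real"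
  assumes K: "compact K" "K \<noteq> {}"
    and f: "continuous_on (D \<times> K) (\<lambda>(x, t). f x t)"
  shows "continuous_on D (\<lambda>x. SUP t\<in>K. f x t)"
    and "\<And>x. x \<in> D \<Longrightarrow> bdd_above (f x ` K)"
    and "\<And>x. x \<in> D \<Longrightarrow> \<exists>t\<in>K. (SUP t\<in>K. f x t) = f x t"
proof -
  have "continuous_on K (f x)" if "x \<in> D" for x
    by (rule continuous_on_compose2[OF f, of K "\<lambda>t. (x, t)", simplified])
      (use that in \<open>auto intro!: continuous_intros\<close>)
  then have cmp: "compact (f x ` K)" if "x \<in> D" for x
    using that K compact_continuous_image by blast
  then show bdd: "bdd_above (f x ` K)" if "x \<in> D" for x
    using that by (simp add: bounded_imp_bdd_above compact_imp_bounded)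
  show att: "\<exists>t\<in>K. (SUP t\<in>K. f x t) = f x t" if "x \<in> D" for x
  proof -
    have "(SUP t\<in>K. f x t) \<in> f x ` K"
      by (rule closed_contains_Sup) (use K(2) bdd[OF that] cmp[OF that] in \<open>simp_all add: compact_imp_closed\<close>)
    then show ?thesis by blast
  qed
  show "continuous_on D (\<lambda>x. SUP t\<in>K. f x t)"
    unfolding continuous_on_def
  proof (intro ballI tendstoI)
    fix x and e :: real assume x: "x \<in> D" and e: "e > 0"
    have "0 < e / 2" using e by simp
    from continuous_on_prod_compactE[OF f K(1) x this, unfolded prod.case]
    obtain X where X: "x \<in> X" "open X"
      and near: "\<forall>y\<in>X \<inter> D. \<forall>t\<in>K. dist (f y t) (f x t) \<le> e / 2" .
    have "dist (SUP t\<in>K. f y t) (SUP t\<in>K. f x t) < e" if y: "y \<in> X \<inter> D" for y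
    proof -
      have "(SUP t\<in>K. f u t) \<le> (SUP t\<in>K. f v t) + e / 2"
        if "v \<in> D" "\<And>t. t \<in> K \<Longrightarrow> dist (f u t) (f v t) \<le> e / 2" for u v
      proof (rule cSUP_least[OF K(2)])
        fix t assume "t \<in> K"
        then have "\<bar>f u t - f v t\<bar> \<le> e / 2"
          unfolding dist_real_def[symmetric] by (rule that(2))
        then have "f u t \<le> f v t + e / 2" by linarith
        also have "f v t \<le> (SUP t\<in>K. f v t)"
          by (rule cSUP_upper[OF \<open>t \<in> K\<close> bdd[OF \<open>v \<in> D\<close>]])
        finally show "f u t \<le> (SUP t\<in>K. f v t) + e / 2" by simp
      qed
      note bound = this
      have "(SUP t\<in>K. f y t) \<le> (SUP t\<in>K. f x t) + e / 2"
        by (rule bound[OF x]) (use near y in blast)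
      moreover have "(SUP t\<in>K. f x t) \<le> (SUP t\<in>K. f y t) + e / 2"
        by (rule bound, use y in blast, subst dist_commute) (use near y in blast)
      ultimately show ?thesis using e unfolding dist_real_def by linarith
    qed
    then show "\<forall>\<^sub>F y in at x within D. dist (SUP t\<in>K. f y t) (SUP t\<in>K. f x t) < e"
      using X unfolding eventually_at_topological by blast
  qed
qed

lemma ext_integral_ereal:
  assumes "integrable M g"
  shows "ext_integral M (\<lambda>x. ereal (g x)) = ereal (integral\<^sup>L M g)"
proof -
  have "(\<integral>\<^sup>+ x. ennreal (g x) \<partial>M) < \<infinity>" "(\<integral>\<^sup>+ x. ennreal (- g x) \<partial>M) < \<infinity>"
    using assms unfolding real_integrable_def by (auto simp: less_top)
  then obtain a b where ab: "(\<integral>\<^sup>+ x. ennreal (g x) \<partial>M) = ennreal a" "(\<integral>\<^sup>+ x. ennreal (- g x) \<partial>M) = ennreal b"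
      "a \<ge> 0" "b \<ge> 0"
    by (metis infinity_ennreal_def less_top_ennreal)
  then show ?thesis
    unfolding ext_integral_def real_lebesgue_integral_def[OF assms]
    by (simp add: enn2ereal_ennreal)
qed

text \<open>This is the triangle inequality applied to the mean value property, which in turn is Cauchy's
  integral formula at the centre of the circle.\<close>

lemma norm_le_circle_mean:
  assumes f: "f holomorphic_on cball c r" and r: "r > 0"
  shows "2 * pi * cmod (f c) \<le> integral {0..2*pi} (\<lambda>t. cmod (f (c + of_real r * cis t)))"
proof -
  let ?g = "\<lambda>t. f (c + of_real r * cis t)"
  have cont: "continuous_on {0..2*pi} ?g"
    by (rule continuous_on_compose2[OF holomorphic_on_imp_continuous_on[OF f]])
      (use r in \<open>auto intro!: continuous_intros simp: dist_norm norm_mult\<close>)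
  have "((\<lambda>u. f u / (u - c)) has_contour_integral (2 * of_real pi * \<i> * f c)) (circlepath c r)"
    by (rule Cauchy_integral_circlepath_simple[OF f]) (use r in simp)
  then have "((\<lambda>t. f (c + r * cis t) / (c + r * cis t - c) * r * \<i> * cis t) has_integral
      (2 * of_real pi * \<i> * f c)) {0..2*pi}"
    unfolding circlepath_def by (subst (asm) has_contour_integral_part_circlepath_iff) auto
  then have "((\<lambda>t. \<i> * ?g t) has_integral (\<i> * (2 * of_real pi * f c))) {0..2*pi}"
    using r by (simp add: mult_ac)
  from has_integral_mult_right[OF this, of "- \<i>"]
  have "(?g has_integral (2 * of_real pi * f c)) {0..2*pi}"
    by (simp add: mult.assoc[symmetric])
  then have "2 * of_real pi * f c = integral {0..2*pi} ?g"
    by (simp add: integral_unique)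
  then have "2 * pi * cmod (f c) = cmod (integral {0..2*pi} ?g)"
    by (metis abs_of_pos norm_mult norm_numeral norm_of_real pi_gt_zero)
  also have "\<dots> \<le> integral {0..2*pi} (\<lambda>t. cmod (?g t))"
    by (rule integral_norm_bound_integral)
      (auto intro!: integrable_continuous_real cont continuous_intros)
  finally show ?thesis .
qed

lemma usc_on_ereal:
  fixes u :: "'a::topological_space \<Rightarrow> real"
  assumes "continuous_on D u"
  shows "usc_on D (\<lambda>x. ereal (u x))"
  unfolding usc_on_def
proof (intro ballI allI impI)
  fix z c assume "z \<in> D" "ereal (u z) < c"
  have "((\<lambda>w. ereal (u w)) \<longlongrightarrow> ereal (u z)) (at z within D)"
    using assms \<open>z \<in> D\<close> by (simp add: continuous_on_def)
  then show "\<forall>\<^sub>F w in at z within D. ereal (u w) < c"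
    using \<open>ereal (u z) < c\<close> by (rule order_tendstoD(2))
qed

text \<open>A supremum of moduli of holomorphic functions that is attained at every point has, at each
  centre \<open>c\<close>, one of these moduli touching it from below; the sub-mean value inequality at \<open>c\<close> is
  inherited from that modulus. The shift by 1 makes the criterion applicable to a supremum that is
  normalized to be negative.\<close>

lemma subharmonic_onI_support:
  fixes u :: "complex \<Rightarrow> real"
  assumes cont: "continuous_on U u"
    and supp: "\<And>c. c \<in> U \<Longrightarrow>
      \<exists>f. f holomorphic_on U \<and> (\<forall>w\<in>U. cmod (f w) - 1 \<le> u w) \<and> cmod (f c) - 1 = u c"
  shows "subharmonic_on U (\<lambda>w. ereal (u w))"
  unfolding subharmonic_on_def
proof (intro conjI allI impI ballI)
  show "usc_on U (\<lambda>w. ereal (u w))"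
    by (rule usc_on_ereal[OF cont])
  fix c r assume r: "0 < (r::real)" and sub: "cball c r \<subseteq> U"
  then have "c \<in> U" by auto
  from supp[OF this] obtain f where f: "f holomorphic_on U"
    "\<And>w. w \<in> U \<Longrightarrow> cmod (f w) - 1 \<le> u w" "cmod (f c) - 1 = u c" by blast
  let ?p = "\<lambda>t. c + of_real r * cis t"
  have p: "?p t \<in> U" for t
    using sub r by (auto simp: dist_norm norm_mult)
  have pc: "continuous_on {0..2*pi} ?p" by (intro continuous_intros)
  have ucont: "continuous_on {0..2*pi} (\<lambda>t. u (?p t))"
    by (rule continuous_on_compose2[OF cont pc]) (use p in auto)
  have fcont: "continuous_on {0..2*pi} (\<lambda>t. cmod (f (?p t)))"
    by (intro continuous_on_norm continuous_on_compose2[OF holomorphic_on_imp_continuous_on[OF f(1)] pc])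
      (use p in auto)
  have "2 * pi * u c = 2 * pi * cmod (f c) - 2 * pi"
    unfolding f(3)[symmetric] by (simp add: algebra_simps)
  also have "\<dots> \<le> integral {0..2*pi} (\<lambda>t. cmod (f (?p t))) - integral {0..2*pi} (\<lambda>t. 1)"
    using norm_le_circle_mean[OF holomorphic_on_subset[OF f(1) sub] r] by simp
  also have "\<dots> = integral {0..2*pi} (\<lambda>t. cmod (f (?p t)) - 1)"
    by (rule integral_diff[symmetric]) (auto intro!: integrable_continuous_real fcont)
  also have "\<dots> \<le> integral {0..2*pi} (\<lambda>t. u (?p t))"
    by (rule integral_le) (auto intro!: integrable_continuous_real fcont ucont continuous_intros f(2) p)
  also have "\<dots> = integral\<^sup>L (lebesgue_on {0..2*pi}) (\<lambda>t. u (?p t))"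
    by (rule lebesgue_integral_eq_integral[symmetric])
      (auto intro: continuous_imp_integrable_real[OF ucont])
  finally have le: "u c \<le> 1 / (2 * pi) * integral\<^sup>L (lebesgue_on {0..2*pi}) (\<lambda>t. u (?p t))"
    by (simp add: field_simps)
  show "ereal (u c) \<le> circle_mean (\<lambda>w. ereal (u w)) c r"
    unfolding circle_mean_def ext_integral_ereal[OF continuous_imp_integrable_real[OF ucont]]
    using le by simp
qed simp

section \<open>Domains contracted by the dilations\<close>

lemma m_action_mult: "m_action m a (m_action m b x) = m_action m (a * b) x"
  by (simp add: m_action_def vec_eq_iff power_mult_distrib)

text \<open>The inclusion of the contracted closure cannot be replaced by balancedness: it excludes that
  the boundary contains a piece of an orbit of the dilations, at whose far end the functional would jump.\<close>

lemma continuous_on_m_minkowski: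
  fixes D :: "(complex ^ 'd) set"
  assumes "open D" and "\<And>i. m $ i \<ge> 1" and "0 \<in> D"
    and shrink: "\<And>x c. x \<in> closure D \<Longrightarrow> 0 \<le> c \<Longrightarrow> c < 1 \<Longrightarrow> m_action m (of_real c) x \<in> D"
  shows "continuous_on UNIV (m_minkowski m D)"
proof -
  define S where "S x = {t::real. t > 0 \<and> m_action m (of_real (1 / t)) x \<in> D}" for x
  have h: "m_minkowski m D x = Inf (S x)" for x
    by (simp add: m_minkowski_def S_def)
  have cont_x: "continuous_on UNIV (m_action m c)" for c
    unfolding m_action_def by (intro continuous_intros)
  have cont_t: "continuous_on {0<..} (\<lambda>t. m_action m (of_real (1 / t)) x)" for x
    unfolding m_action_def by (intro continuous_intros) auto
  have bdd: "bdd_below (S x)" for x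
    by (auto intro!: bdd_belowI[of _ 0] simp: S_def)
  \<comment> \<open>Passing from \<open>t\<close> to a larger \<open>t'\<close> composes with the contraction by \<open>t / t'\<close>.\<close>
  have up: "t' \<in> S x" if "t > 0" "m_action m (of_real (1 / t)) x \<in> closure D" "t < t'" for t t' x
  proof -
    have "m_action m (of_real (t / t')) (m_action m (of_real (1 / t)) x) \<in> D"
      by (rule shrink) (use that in auto)
    then show ?thesis using that by (simp add: m_action_mult S_def of_real_mult[symmetric] del: of_real_mult of_real_divide)
  qed
  have ne: "S x \<noteq> {}" for x
  proof -
    have "((\<lambda>t::real. m_action m (of_real (1 / t)) x) \<longlongrightarrow> 0) at_top"
    proof (rule vec_tendstoI)
      fix i
      have "((\<lambda>t::real. complex_of_real (1 / t)) \<longlongrightarrow> of_real 0) at_top"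
        by (intro tendsto_of_real tendsto_divide_0[OF tendsto_const] filterlim_at_top_imp_at_infinity filterlim_ident)
      from tendsto_mult[OF tendsto_power[OF this, of "m $ i"] tendsto_const[of "x $ i"]]
      have "((\<lambda>t::real. complex_of_real (1 / t) ^ (m $ i) * x $ i) \<longlongrightarrow> of_real 0 ^ (m $ i) * x $ i) at_top" .
      then show "((\<lambda>t::real. m_action m (of_real (1 / t)) x $ i) \<longlongrightarrow> 0 $ i) at_top"
        using assms(2)[of i] by (simp add: m_action_def power_0_left)
    qed
    from topological_tendstoD[OF this assms(1,3)]
    have "\<forall>\<^sub>F t::real in at_top. t > 0 \<and> m_action m (of_real (1 / t)) x \<in> D"
      by (intro eventually_conj eventually_gt_at_top)
    then show ?thesis
      unfolding S_def by (metis (mono_tags, lifting) empty_Collect_eq eventually_at_top_linorder order_refl)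
  qed
  have nonneg: "0 \<le> m_minkowski m D x" for x
    unfolding h by (rule cInf_greatest[OF ne]) (simp add: S_def)
  \<comment> \<open>Openness gives a little room: a dilation by slightly more than \<open>1 / r\<close> still lands in \<open>D\<close>.\<close>
  have less: "m_minkowski m D x < r \<longleftrightarrow> m_action m (of_real (1 / r)) x \<in> D" if r: "r > 0" for x r
  proof
    assume "m_minkowski m D x < r"
    then obtain t where "t \<in> S x" "t < r" unfolding h cInf_less_iff[OF ne bdd] by blast
    with up[of t x r] closure_subset show "m_action m (of_real (1 / r)) x \<in> D"
      by (auto simp: S_def)
  next
    assume "m_action m (of_real (1 / r)) x \<in> D"
    with cont_t[of x] r assms(1) have "\<forall>\<^sub>F t in at r within {0<..}. m_action m (of_real (1 / t)) x \<in> D"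
      unfolding continuous_on_def by (metis greaterThan_iff topological_tendstoD)
    then have "\<forall>\<^sub>F t in at r. m_action m (of_real (1 / t)) x \<in> D"
      using r by (simp add: at_within_open[of r "{0<..}"])
    then have "\<forall>\<^sub>F t in at_left r. m_action m (of_real (1 / t)) x \<in> D"
      by (simp add: eventually_at_split)
    moreover have "\<forall>\<^sub>F t in at_left r. t > 0 \<and> t < r"
      using eventually_at_left_real[OF r] by eventually_elim auto
    ultimately have "\<forall>\<^sub>F t in at_left r. t \<in> S x \<and> t < r"
      by eventually_elim (auto simp: S_def)
    then obtain t where "t \<in> S x" "t < r"
      using eventually_happens by fastforce
    then show "m_minkowski m D x < r" unfolding h cInf_less_iff[OF ne bdd] by blast
  qed
  have le: "m_action m (of_real (1 / r)) x \<in> closure D \<Longrightarrow> m_minkowski m D x \<le> r" if r: "r > 0" for x r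
  proof (rule dense_ge)
    fix t assume "m_action m (of_real (1 / r)) x \<in> closure D" "r < t"
    with up[OF r] show "m_minkowski m D x \<le> t" unfolding h by (intro cInf_lower bdd)
  qed
  show ?thesis
    unfolding continuous_on_def
  proof (intro ballI order_tendstoI)
    fix x a assume a: "a < m_minkowski m D x"
    show "\<forall>\<^sub>F y in at x within UNIV. a < m_minkowski m D y"
    proof (cases "a < 0")
      case True
      then show ?thesis by (intro always_eventually allI less_le_trans[OF _ nonneg])
    next
      case False
      obtain r where r: "a < r" "r < m_minkowski m D x" using dense[OF a] by blast
      let ?V = "m_action m (of_real (1 / r)) -` (- closure D)"
      have "open ?V" by (rule open_vimage[OF _ cont_x]) auto
      moreover have "x \<in> ?V" using le[of r x] r False by force
      moreover have "a < m_minkowski m D y" if "y \<in> ?V" for y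
        using less[of r y] that r False closure_subset[of D] by force
      ultimately show ?thesis unfolding eventually_at_topological by blast
    qed
  next
    fix x a assume a: "m_minkowski m D x < a"
    then have "a > 0" using nonneg[of x] by simp
    let ?V = "m_action m (of_real (1 / a)) -` D"
    have "open ?V" by (rule open_vimage[OF assms(1) cont_x])
    with a less[OF \<open>a > 0\<close>] show "\<forall>\<^sub>F y in at x within UNIV. m_minkowski m D y < a"
      unfolding eventually_at_topological by blast
  qed
qed

lemma connected_if_shrinks_to_0:
  fixes D :: "(complex ^ 'd) set"
  assumes "\<And>i. m $ i \<ge> 1"
    and shrink: "\<And>x c. x \<in> D \<Longrightarrow> 0 \<le> c \<Longrightarrow> c < 1 \<Longrightarrow> m_action m (of_real c) x \<in> D"
  shows "connected D"
proof -
  define C where "C x = (\<lambda>c::real. m_action m (of_real c) x) ` {0..1}" for x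
  have one: "m_action m (of_real 1) x = x" for x
    by (simp add: m_action_def vec_eq_iff)
  have zero: "m_action m (of_real 0) x = 0" for x
  proof -
    have "(0::complex) ^ (m $ i) = 0" for i
      using assms(1)[of i] by (simp add: power_0_left)
    then show ?thesis by (simp add: m_action_def vec_eq_iff)
  qed
  have "connected (C x)" for x
    unfolding C_def m_action_def
    by (intro connected_continuous_image continuous_intros connected_Icc)
  moreover have "x \<in> C x" for x
    unfolding C_def by (rule image_eqI[where x = 1], rule one[symmetric]) simp
  moreover have "0 \<in> C x" for x
    unfolding C_def by (rule image_eqI[where x = 0], rule zero[symmetric]) simp
  moreover have "C x \<subseteq> D" if "x \<in> D" for x
  proof
    fix y assume "y \<in> C x"
    then obtain c where "y = m_action m (of_real c) x" "0 \<le> c" "c \<le> 1" by (auto simp: C_def)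
    with shrink[OF that, of c] one[of x] that show "y \<in> D" by (cases "c = 1") auto
  qed
  ultimately have "D = \<Union> (C ` D)" "connected (\<Union> (C ` D))"
    by (blast, intro connected_Union) blast+
  then show ?thesis by simp
qed

section \<open>Bounds on the symmetrized bidisc\<close>

lemma sym_bidisc_iff_roots:
  assumes "s = u + v" "p = u * v"
  shows "(s, p) \<in> sym_bidisc \<longleftrightarrow> cmod u < 1 \<and> cmod v < 1"
proof
  assume L: "(s, p) \<in> sym_bidisc"
  have "cmod x < 1" if x: "x = u \<or> x = v" for x
  proof (rule ccontr)
    assume "\<not> cmod x < 1"
    then have x0: "x \<noteq> 0" and "1 / x \<in> cball 0 1"
      by (auto simp: norm_divide divide_simps)
    have "1 - s * (1 / x) + p * (1 / x)\<^sup>2 = 0"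
      using x x0 assms by (auto simp: field_simps power2_eq_square)
    with L \<open>1 / x \<in> cball 0 1\<close> show False
      unfolding sym_bidisc_def by blast
  qed
  then show "cmod u < 1 \<and> cmod v < 1" by blast
next
  assume R: "cmod u < 1 \<and> cmod v < 1"
  have "1 - s * z + p * z\<^sup>2 \<noteq> 0" if "cmod z \<le> 1" for z
  proof -
    have "cmod (u * z) < 1" "cmod (v * z) < 1"
      using R that by (smt (verit) mult_left_le norm_ge_zero norm_mult)+
    then have "1 - u * z \<noteq> 0" "1 - v * z \<noteq> 0" by auto
    moreover have "1 - s * z + p * z\<^sup>2 = (1 - u * z) * (1 - v * z)"
      using assms by (simp add: algebra_simps power2_eq_square)
    ultimately show ?thesis by simp
  qed
  then show "(s, p) \<in> sym_bidisc" by (auto simp: sym_bidisc_def)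
qed

lemma obtain_roots:
  fixes s p :: complex
  obtains u v where "s = u + v" "p = u * v"
proof
  define d where "d = csqrt (s\<^sup>2 - 4 * p)"
  have "d\<^sup>2 = s\<^sup>2 - 4 * p" by (simp add: d_def)
  then show "s = (s + d) / 2 + (s - d) / 2" "p = (s + d) / 2 * ((s - d) / 2)"
    by (auto simp: field_simps power2_eq_square)
qed

text \<open>All bounds are read off the roots \<open>u, v\<close> of \<open>X\<^sup>2 - s X + p\<close>, which lie in the open disc. The
  second one is \<open>0 < (1 - \<bar>u\<bar>) (1 - \<bar>v\<bar>)\<close>; the third one, which says \<open>\<bar>\<beta>\<bar> < 1\<close>, comes from
  \<open>s - cnj s * p = u (1 - \<bar>v\<bar>\<^sup>2) + v (1 - \<bar>u\<bar>\<^sup>2)\<close>. The last one is a quantitative form of the absence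
  of zeros that, being a weak inequality, persists on the closure.\<close>

lemma sym_bidisc_bounds:
  assumes "(s, p) \<in> sym_bidisc"
  shows "cmod p < 1" and "cmod s < 1 + cmod p" and "cmod (s - cnj s * p) < 1 - (cmod p)\<^sup>2"
    and "\<And>z. cmod z \<le> 1 \<Longrightarrow> (1 - cmod z)\<^sup>2 \<le> cmod (1 - s * z + p * z\<^sup>2)"
proof -
  obtain u v where uv: "s = u + v" "p = u * v" by (rule obtain_roots)
  then have lt: "cmod u < 1" "cmod v < 1"
    using assms sym_bidisc_iff_roots by auto
  have "cmod u * cmod v < 1 * 1"
    by (rule mult_strict_mono') (use lt in auto)
  then show p: "cmod p < 1" by (simp add: uv norm_mult)
  have "0 < (1 - cmod u) * (1 - cmod v)" using lt by simp
  then have sum: "cmod u + cmod v < 1 + cmod p"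
    by (simp add: uv norm_mult algebra_simps)
  then show "cmod s < 1 + cmod p"
    unfolding uv(1) by (smt (verit) norm_triangle_ineq)
  have "s - cnj s * p = u * of_real (1 - (cmod v)\<^sup>2) + v * of_real (1 - (cmod u)\<^sup>2)"
    unfolding uv of_real_diff complex_norm_square by (simp add: algebra_simps)
  also have "cmod \<dots> \<le> cmod u * (1 - (cmod v)\<^sup>2) + cmod v * (1 - (cmod u)\<^sup>2)"
    by (rule order_trans[OF norm_triangle_ineq])
      (use lt in \<open>simp only: norm_mult norm_of_real, simp add: power_le_one\<close>)
  also have "\<dots> = (cmod u + cmod v) * (1 - cmod p)"
    by (simp add: uv norm_mult algebra_simps power2_eq_square)
  also have "\<dots> < (1 + cmod p) * (1 - cmod p)"
    by (rule mult_strict_right_mono) (use sum p in auto)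
  finally show "cmod (s - cnj s * p) < 1 - (cmod p)\<^sup>2"
    by (simp add: algebra_simps power2_eq_square)
  fix z :: complex assume z: "cmod z \<le> 1"
  have le: "1 - cmod z \<le> cmod (1 - x * z)" if "cmod x < 1" for x
  proof -
    have "cmod (x * z) \<le> cmod z"
      using that by (simp add: norm_mult mult_left_le_one_le)
    then show ?thesis by (smt (verit) norm_triangle_ineq2 norm_one)
  qed
  have "(1 - cmod z)\<^sup>2 \<le> cmod (1 - u * z) * cmod (1 - v * z)"
    unfolding power2_eq_square by (rule mult_mono) (use z le lt in auto)
  also have "\<dots> = cmod (1 - s * z + p * z\<^sup>2)"
    unfolding norm_mult[symmetric] uv by (simp add: algebra_simps power2_eq_square)
  finally show "(1 - cmod z)\<^sup>2 \<le> cmod (1 - s * z + p * z\<^sup>2)" .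
qed

section \<open>The pentablock as a family of inequalities\<close>

lemma norm_moebius_le:
  assumes "cmod p \<le> 1" "cmod w \<le> 1"
  shows "cmod (p - cnj w) \<le> cmod (1 - p * w)"
proof -
  have "(cmod (1 - p * w))\<^sup>2 - (cmod (p - cnj w))\<^sup>2 = (1 - (cmod p)\<^sup>2) * (1 - (cmod w)\<^sup>2)"
    unfolding cmod_power2 by (simp add: algebra_simps power2_eq_square)
  also have "\<dots> \<ge> 0"
    using assms by (intro mult_nonneg_nonneg) (auto simp: power_le_one)
  finally show ?thesis
    unfolding diff_ge_0_iff_ge by (rule power2_le_imp_le) (rule norm_ge_zero)
qed

text \<open>With \<open>M = 1 - cnj \<zeta> * z\<close>, \<open>N = z - \<zeta>\<close> and \<open>d = 1 - \<bar>\<zeta>\<bar>\<^sup>2\<close> one has \<open>d = M + cnj \<zeta> * N\<close> and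
  \<open>d * z = N + \<zeta> * M\<close>. In these coordinates the quadratic polynomial on the right becomes, after
  multiplication by \<open>d\<close>, the diagonal form \<open>M\<^sup>2 (1 - p \<zeta>\<^sup>2) + N\<^sup>2 (p - cnj \<zeta>\<^sup>2)\<close>, while
  \<open>d (1 - \<bar>z\<bar>\<^sup>2) = \<bar>M\<bar>\<^sup>2 - \<bar>N\<bar>\<^sup>2\<close>. As the coefficient of \<open>N\<^sup>2\<close> is dominated by that of \<open>M\<^sup>2\<close>, the triangle
  inequality finishes the proof.\<close>

lemma norm_quadratic_ge:
  fixes p \<zeta> z :: complex
  assumes "cmod p \<le> 1" "cmod \<zeta> < 1"
  shows "(1 - (cmod z)\<^sup>2) * cmod (1 - p * \<zeta>\<^sup>2)
    \<le> cmod (1 + of_real ((cmod \<zeta>)\<^sup>2) - 2 * cnj \<zeta> * z + p * z * ((1 + of_real ((cmod \<zeta>)\<^sup>2)) * z - 2 * \<zeta>))"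
    (is "_ \<le> cmod ?Q")
proof -
  define d where "d = 1 - (cmod \<zeta>)\<^sup>2"
  define M where "M = 1 - cnj \<zeta> * z"
  define N where "N = z - \<zeta>"
  have d: "d > 0" using assms by (simp add: d_def power_less_one_iff abs_square_less_1)
  have MN: "(cmod M)\<^sup>2 - (cmod N)\<^sup>2 = d * (1 - (cmod z)\<^sup>2)"
    unfolding M_def N_def d_def cmod_power2 by (simp add: algebra_simps power2_eq_square)
  have "of_real d * ?Q = M\<^sup>2 * (1 - p * \<zeta>\<^sup>2) + N\<^sup>2 * (p - cnj (\<zeta>\<^sup>2))"
  proof -
    have "of_real d = 1 - \<zeta> * cnj \<zeta>" "complex_of_real ((cmod \<zeta>)\<^sup>2) = \<zeta> * cnj \<zeta>"
      unfolding d_def of_real_diff complex_norm_square by simp_all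
    then show ?thesis
      using M_def N_def complex_cnj_power[of \<zeta> 2] by algebra
  qed
  from arg_cong[OF this, of cmod]
  have "d * cmod ?Q = cmod (M\<^sup>2 * (1 - p * \<zeta>\<^sup>2) + N\<^sup>2 * (p - cnj (\<zeta>\<^sup>2)))"
    unfolding norm_mult[of "of_real d"] norm_of_real using d by (simp only: abs_of_pos)
  also have "\<dots> \<ge> (cmod M)\<^sup>2 * cmod (1 - p * \<zeta>\<^sup>2) - (cmod N)\<^sup>2 * cmod (p - cnj (\<zeta>\<^sup>2))"
    by (rule order_trans[OF _ norm_diff_ineq]) (simp only: norm_mult norm_power)
  moreover have "(cmod N)\<^sup>2 * cmod (p - cnj (\<zeta>\<^sup>2)) \<le> (cmod N)\<^sup>2 * cmod (1 - p * \<zeta>\<^sup>2)"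
    by (intro mult_left_mono norm_moebius_le)
      (use assms in \<open>auto simp: norm_power power_le_one\<close>)
  ultimately have "((cmod M)\<^sup>2 - (cmod N)\<^sup>2) * cmod (1 - p * \<zeta>\<^sup>2) \<le> d * cmod ?Q"
    unfolding left_diff_distrib by linarith
  then show ?thesis
    using d unfolding MN mult.assoc by (rule mult_left_le_imp_le)
qed

definition fibre_radius :: "complex \<Rightarrow> complex \<Rightarrow> real" where
  "fibre_radius s p = cmod (1 - (1/2 * s * cnj (penta_beta s p)) /
     of_real (1 + sqrt (1 - (cmod (penta_beta s p))\<^sup>2)))"

text \<open>Recall \<open>s = \<beta> + cnj \<beta> * p\<close>. For \<open>\<zeta> = cnj \<beta> / (1 + r)\<close> with \<open>r = sqrt (1 - \<bar>\<beta>\<bar>\<^sup>2)\<close> the polynomial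
  \<open>1 - s z + p z\<^sup>2\<close> is \<open>h = (1 + r) / 2 = 1 / (1 + \<bar>\<zeta>\<bar>\<^sup>2)\<close> times the one bounded in \<open>norm_quadratic_ge\<close>,
  and the radius is \<open>h * \<bar>1 - p \<zeta>\<^sup>2\<bar>\<close>. Equality holds at \<open>z = \<zeta>\<close>, where \<open>N\<close> vanishes.\<close>

lemma fibre_radius_minimum:
  assumes G: "(s, p) \<in> sym_bidisc"
  shows fibre_radius_le: "\<And>z. fibre_radius s p * (1 - (cmod z)\<^sup>2) \<le> cmod (1 - s * z + p * z\<^sup>2)"
    and fibre_radius_attained: "\<exists>\<zeta>. cmod \<zeta> < 1 \<and> fibre_radius s p * (1 - (cmod \<zeta>)\<^sup>2) = cmod (1 - s * \<zeta> + p * \<zeta>\<^sup>2)"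
proof -
  define \<beta> where "\<beta> = penta_beta s p"
  define q where "q = 1 - (cmod p)\<^sup>2"
  have p: "cmod p < 1" using sym_bidisc_bounds(1)[OF G] .
  then have q: "q > 0" by (simp add: q_def abs_square_less_1)
  have "cmod (s - cnj s * p) < q"
    using sym_bidisc_bounds(3)[OF G] by (simp add: q_def)
  then have b: "cmod \<beta> < 1"
    using q by (simp add: \<beta>_def penta_beta_def norm_divide q_def[symmetric] del: of_real_diff)
  have s: "s = \<beta> + cnj \<beta> * p"
  proof -
    have "of_real q * \<beta> = s - cnj s * p"
      using q by (simp add: \<beta>_def penta_beta_def q_def[symmetric] del: of_real_diff)
    moreover from arg_cong[OF this, of cnj]
    have "of_real q * cnj \<beta> = cnj s - s * cnj p" by simp
    ultimately have "of_real q * (\<beta> + cnj \<beta> * p) = s - cnj s * p + (cnj s - s * cnj p) * p"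
      by algebra
    also have "\<dots> = of_real q * s"
      unfolding q_def of_real_diff complex_norm_square by (simp add: algebra_simps)
    finally show ?thesis using q by simp
  qed
  define r where "r = sqrt (1 - (cmod \<beta>)\<^sup>2)"
  have r: "r > 0" "r\<^sup>2 = 1 - (cmod \<beta>)\<^sup>2"
    using b by (auto simp: r_def abs_square_less_1 abs_square_le_1)
  define h where "h = (1 + r) / 2"
  have h: "h > 0" "1 + r = 2 * h" using r by (simp_all add: h_def)
  define \<zeta> where "\<zeta> = cnj \<beta> / of_real (1 + r)"
  have b\<zeta>: "cnj \<beta> = 2 * of_real h * \<zeta>" "\<beta> = 2 * of_real h * cnj \<zeta>"
    using h(1) unfolding \<zeta>_def h(2) by simp_all
  have hx: "h * (1 + (cmod \<zeta>)\<^sup>2) = 1"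
  proof -
    have "(2 * h)\<^sup>2 * (cmod \<zeta>)\<^sup>2 = (cmod \<beta>)\<^sup>2"
      unfolding b\<zeta>(2) norm_mult norm_of_real power_mult_distrib using h by simp
    also have "\<dots> = (1 + r) * (2 - (1 + r))" using r by (simp add: algebra_simps power2_eq_square)
    also have "\<dots> = (2 * h) * (2 - 2 * h)" by (simp only: h(2))
    finally have "h * (h * (1 + (cmod \<zeta>)\<^sup>2)) = h * 1"
      by (simp add: power2_eq_square algebra_simps)
    then show ?thesis using h(1) by (simp only: mult_cancel_left) simp
  qed
  have "(cmod \<zeta>)\<^sup>2 < 1"
  proof -
    have "h * 2 > h * (1 + (cmod \<zeta>)\<^sup>2)" using hx h r by simp
    then show ?thesis using h(1) by simp
  qed
  then have lt: "cmod \<zeta> < 1" by (simp add: abs_square_less_1)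
  have e: "of_real h * (1 + of_real ((cmod \<zeta>)\<^sup>2)) = (1::complex)"
    using arg_cong[OF hx, of complex_of_real] by (simp only: of_real_mult of_real_add of_real_1)
  then have e': "of_real h * (cnj \<zeta> * \<zeta>) = 1 - of_real h"
    unfolding complex_norm_square by (simp add: algebra_simps)
  have s': "s = 2 * of_real h * cnj \<zeta> + 2 * of_real h * \<zeta> * p"
    by (simp only: s b\<zeta>[symmetric])
  have R: "fibre_radius s p = h * cmod (1 - p * \<zeta>\<^sup>2)"
  proof -
    have "1 - (1/2 * s * cnj \<beta>) / of_real (1 + r) = 1 - 1/2 * s * \<zeta>"
      by (simp only: \<zeta>_def times_divide_eq_right)
    also have "\<dots> = 1 - of_real h * (cnj \<zeta> * \<zeta>) - of_real h * p * \<zeta>\<^sup>2"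
      using s' by algebra
    also have "\<dots> = of_real h * (1 - p * \<zeta>\<^sup>2)"
      unfolding e' by (simp add: algebra_simps)
    finally show ?thesis
      unfolding fibre_radius_def \<beta>_def[symmetric] r_def[symmetric] using h(1) by (simp only: norm_mult norm_of_real abs_of_pos)
  qed
  have Q: "1 - s * z + p * z\<^sup>2 = of_real h * (1 + of_real ((cmod \<zeta>)\<^sup>2) - 2 * cnj \<zeta> * z
       + p * z * ((1 + of_real ((cmod \<zeta>)\<^sup>2)) * z - 2 * \<zeta>))" (is "_ = _ * ?B z")
    for z
  proof -
    have "of_real h * ?B z = (of_real h * (1 + of_real ((cmod \<zeta>)\<^sup>2))) * (1 + p * z\<^sup>2)
       - (2 * of_real h * cnj \<zeta> + 2 * of_real h * \<zeta> * p) * z"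
      by (simp add: algebra_simps power2_eq_square)
    also have "\<dots> = 1 - s * z + p * z\<^sup>2"
      unfolding e s'[symmetric] by simp
    finally show ?thesis by simp
  qed
  show "fibre_radius s p * (1 - (cmod z)\<^sup>2) \<le> cmod (1 - s * z + p * z\<^sup>2)" for z
  proof -
    have "h * ((1 - (cmod z)\<^sup>2) * cmod (1 - p * \<zeta>\<^sup>2)) \<le> h * cmod (?B z)"
      using norm_quadratic_ge[of p \<zeta> z] p lt h by (intro mult_left_mono) auto
    also have "\<dots> = cmod (1 - s * z + p * z\<^sup>2)"
      unfolding Q using h(1) by (simp only: norm_mult norm_of_real abs_of_pos)
    finally show ?thesis unfolding R by (simp only: mult_ac)
  qed
  have "?B \<zeta> = of_real (1 - (cmod \<zeta>)\<^sup>2) * (1 - p * \<zeta>\<^sup>2)"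
  proof -
    have "complex_of_real ((cmod \<zeta>)\<^sup>2) = \<zeta> * cnj \<zeta>" by (rule complex_norm_square)
    then show ?thesis unfolding of_real_diff of_real_1 by algebra
  qed
  moreover have "1 - (cmod \<zeta>)\<^sup>2 > 0" using lt by (simp add: abs_square_less_1)
  ultimately have "cmod (1 - s * \<zeta> + p * \<zeta>\<^sup>2) = h * ((1 - (cmod \<zeta>)\<^sup>2) * cmod (1 - p * \<zeta>\<^sup>2))"
    unfolding Q using h(1) by (simp only: norm_mult norm_of_real abs_of_pos)
  then have "fibre_radius s p * (1 - (cmod \<zeta>)\<^sup>2) = cmod (1 - s * \<zeta> + p * \<zeta>\<^sup>2)"
    unfolding R by (simp only: mult_ac)
  with lt show "\<exists>\<zeta>. cmod \<zeta> < 1 \<and> fibre_radius s p * (1 - (cmod \<zeta>)\<^sup>2) = cmod (1 - s * \<zeta> + p * \<zeta>\<^sup>2)"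
    by (intro exI[of _ \<zeta>] conjI)
qed

text \<open>Inside the disc the inequality is division by \<open>1 - \<bar>z\<bar>\<^sup>2\<close> of the comparison with the minimum; on
  the circle its left-hand side is 0 and it expresses non-vanishing, so that membership of \<open>(s, p)\<close>
  in the symmetrized bidisc is included.\<close>

lemma pentablock_iff:
  "x \<in> pentablock \<longleftrightarrow>
    (\<forall>z\<in>cball 0 1. cmod (x$1) * (1 - (cmod z)\<^sup>2) < cmod (1 - x$2 * z + x$3 * z\<^sup>2))"
proof -
  define R where "R = fibre_radius (x$2) (x$3)"
  have v: "x = vector [a, s, p] \<longleftrightarrow> a = x$1 \<and> s = x$2 \<and> p = x$3" for a s p
    by (auto simp: vec_eq_iff forall_3)
  have P: "x \<in> pentablock \<longleftrightarrow> (x$2, x$3) \<in> sym_bidisc \<and> cmod (x$1) < R"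
    unfolding pentablock_def fibre_radius_def[symmetric] mem_Collect_eq v R_def by blast
  show ?thesis
  proof
    assume "x \<in> pentablock"
    with P have G: "(x$2, x$3) \<in> sym_bidisc" and R: "cmod (x$1) < R" by auto
    show "\<forall>z\<in>cball 0 1. cmod (x$1) * (1 - (cmod z)\<^sup>2) < cmod (1 - x$2 * z + x$3 * z\<^sup>2)"
    proof
      fix z :: complex assume z: "z \<in> cball 0 1"
      show "cmod (x$1) * (1 - (cmod z)\<^sup>2) < cmod (1 - x$2 * z + x$3 * z\<^sup>2)"
      proof (cases "cmod z = 1")
        case True
        then show ?thesis using G z by (auto simp: sym_bidisc_def)
      next
        case False
        then have "0 < 1 - (cmod z)\<^sup>2" using z by (simp add: abs_square_less_1)
        then have "cmod (x$1) * (1 - (cmod z)\<^sup>2) < R * (1 - (cmod z)\<^sup>2)" using R by simp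
        also have "\<dots> \<le> cmod (1 - x$2 * z + x$3 * z\<^sup>2)"
          using fibre_radius_le[OF G] unfolding R_def .
        finally show ?thesis .
      qed
    qed
  next
    assume A: "\<forall>z\<in>cball 0 1. cmod (x$1) * (1 - (cmod z)\<^sup>2) < cmod (1 - x$2 * z + x$3 * z\<^sup>2)"
    have G: "(x$2, x$3) \<in> sym_bidisc"
    proof -
      have "1 - x$2 * z + x$3 * z\<^sup>2 \<noteq> 0" if "cmod z \<le> 1" for z
      proof -
        have "0 \<le> cmod (x$1) * (1 - (cmod z)\<^sup>2)"
          using that by (simp add: power_le_one)
        also have "\<dots> < cmod (1 - x$2 * z + x$3 * z\<^sup>2)"
          by (rule A[rule_format]) (simp add: that)
        finally show ?thesis unfolding zero_less_norm_iff .
      qed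
      then show ?thesis unfolding sym_bidisc_def by simp
    qed
    from fibre_radius_attained[OF G] obtain \<zeta> where \<zeta>: "cmod \<zeta> < 1"
      "R * (1 - (cmod \<zeta>)\<^sup>2) = cmod (1 - x$2 * \<zeta> + x$3 * \<zeta>\<^sup>2)"
      unfolding R_def by blast
    have "cmod (x$1) * (1 - (cmod \<zeta>)\<^sup>2) < R * (1 - (cmod \<zeta>)\<^sup>2)"
      unfolding \<zeta>(2) by (rule A[rule_format]) (use \<zeta>(1) in simp)
    moreover have "0 < 1 - (cmod \<zeta>)\<^sup>2" using \<zeta>(1) by (simp add: abs_square_less_1)
    ultimately have "cmod (x$1) < R" by (rule mult_right_less_imp_less[OF _ less_imp_le])
    with G P show "x \<in> pentablock" by blast
  qed
qed

section \<open>Topology of the pentablock\<close>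

lemma pentablock_denominator_pos:
  assumes "x \<in> pentablock" "cmod z \<le> 1"
  shows "0 < cmod (1 - x$2 * z + x$3 * z\<^sup>2)"
proof -
  have "0 \<le> cmod (x$1) * (1 - (cmod z)\<^sup>2)"
    using assms(2) by (simp add: power_le_one)
  also have "\<dots> < cmod (1 - x$2 * z + x$3 * z\<^sup>2)"
    using assms unfolding pentablock_iff by simp
  finally show ?thesis .
qed

lemma pentablock_sym_bidisc:
  assumes "x \<in> pentablock"
  shows "(x$2, x$3) \<in> sym_bidisc"
  using pentablock_denominator_pos[OF assms] unfolding sym_bidisc_def by fastforce

lemma open_pentablock: "open pentablock"
proof -
  let ?f = "\<lambda>(x::complex^3) z. cmod (x$1) * (1 - (cmod z)\<^sup>2) - cmod (1 - x$2 * z + x$3 * z\<^sup>2)"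
  have f: "continuous_on (UNIV \<times> cball 0 1) (\<lambda>(x, z). ?f x z)"
    by (auto simp: case_prod_unfold intro!: continuous_intros)
  note S = continuous_on_SUP_compact[OF compact_cball _ f, simplified]
  have "pentablock = {x. (SUP z\<in>cball 0 1. ?f x z) < 0}"
  proof (intro set_eqI iffI CollectI)
    fix x assume x: "x \<in> pentablock"
    obtain z where "z \<in> cball 0 1" "(SUP z\<in>cball 0 1. ?f x z) = ?f x z"
      using S(3)[of x] by auto
    then show "(SUP z\<in>cball 0 1. ?f x z) < 0"
      using x unfolding pentablock_iff by simp
  next
    fix x assume "x \<in> {x. (SUP z\<in>cball 0 1. ?f x z) < 0}"
    then have "(SUP z\<in>cball 0 1. ?f x z) < 0" by blast
    moreover have "?f x z \<le> (SUP z\<in>cball 0 1. ?f x z)" if "z \<in> cball 0 1" for z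
      by (rule cSUP_upper[OF that S(2)])
    ultimately have "?f x z < 0" if "z \<in> cball 0 1" for z
      using that by (meson le_less_trans)
    then show "x \<in> pentablock" unfolding pentablock_iff by simp
  qed
  also have "open \<dots>" by (rule open_Collect_less[OF S(1)]) (rule continuous_on_const)
  finally show ?thesis .
qed

lemma bounded_pentablock: "bounded pentablock"
proof (rule boundedI)
  fix x assume x: "x \<in> pentablock"
  from x have "cmod (x$1) * (1 - (cmod 0)\<^sup>2) < cmod (1 - x$2 * 0 + x$3 * 0\<^sup>2)"
    unfolding pentablock_iff by (rule bspec) simp
  then have 1: "cmod (x$1) < 1" by simp
  have 23: "cmod (x$2) < 1 + cmod (x$3)" "cmod (x$3) < 1"
    using sym_bidisc_bounds(1,2)[OF pentablock_sym_bidisc[OF x]] by auto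
  have "norm x \<le> (\<Sum>i\<in>UNIV. cmod (x $ i))"
    unfolding norm_vec_def by (rule L2_set_le_sum) simp
  with 1 23 show "norm x \<le> 4" by (simp add: sum_3)
qed

lemma closure_pentablock:
  assumes "x \<in> closure pentablock" "cmod z \<le> 1"
  shows "cmod (x$1) * (1 - (cmod z)\<^sup>2) \<le> cmod (1 - x$2 * z + x$3 * z\<^sup>2)"
    and "(1 - cmod z)\<^sup>2 \<le> cmod (1 - x$2 * z + x$3 * z\<^sup>2)"
proof -
  have "closure pentablock \<subseteq> {x. cmod (x$1) * (1 - (cmod z)\<^sup>2) \<le> cmod (1 - x$2 * z + x$3 * z\<^sup>2)}"
  proof (rule closure_minimal)
    show "pentablock \<subseteq> {x. cmod (x$1) * (1 - (cmod z)\<^sup>2) \<le> cmod (1 - x$2 * z + x$3 * z\<^sup>2)}"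
      using assms(2) by (auto simp: pentablock_iff intro: less_imp_le)
  qed (intro closed_Collect_le continuous_intros)
  then show "cmod (x$1) * (1 - (cmod z)\<^sup>2) \<le> cmod (1 - x$2 * z + x$3 * z\<^sup>2)"
    using assms(1) by blast
  have "closure pentablock \<subseteq> {x. (1 - cmod z)\<^sup>2 \<le> cmod (1 - x$2 * z + x$3 * z\<^sup>2)}"
  proof (rule closure_minimal)
    show "pentablock \<subseteq> {x. (1 - cmod z)\<^sup>2 \<le> cmod (1 - x$2 * z + x$3 * z\<^sup>2)}"
      using sym_bidisc_bounds(4)[OF pentablock_sym_bidisc assms(2)] by blast
  qed (intro closed_Collect_le continuous_intros)
  then show "(1 - cmod z)\<^sup>2 \<le> cmod (1 - x$2 * z + x$3 * z\<^sup>2)"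
    using assms(1) by blast
qed

text \<open>Put \<open>w = c z\<close>, so that the quadratic polynomial of the contracted point at \<open>z\<close> is that of \<open>x\<close> at
  \<open>w\<close>. The inequality at \<open>w\<close> becomes strict because
  \<open>c\<^sup>k (1 - \<bar>z\<bar>\<^sup>2) \<le> c (1 - \<bar>z\<bar>\<^sup>2) < 1 - c\<^sup>2 \<bar>z\<bar>\<^sup>2\<close>; this is where \<open>k \<ge> 1\<close> enters. For \<open>a = 0\<close> both sides of
  this chain are multiplied by 0, and strictness comes from \<open>\<bar>w\<bar> < 1\<close>.\<close>

lemma pentablock_shrink:
  assumes x: "x \<in> closure pentablock" and c: "0 \<le> c" "c < 1" and k: "k \<ge> 1"
  shows "m_action (vector [k, 1, 2]) (of_real c) x \<in> pentablock"
  unfolding pentablock_iff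
proof
  fix z :: complex assume "z \<in> cball 0 1"
  then have z: "cmod z \<le> 1" by simp
  let ?w = "of_real c * z" and ?y = "m_action (vector [k, 1, 2]) (of_real c) x"
  have w: "cmod ?w = c * cmod z" using c by (simp add: norm_mult)
  have "c * cmod z \<le> c * 1" by (rule mult_left_mono) (use z c in auto)
  with c w have w1: "cmod ?w < 1" by linarith
  then have w1': "cmod ?w \<le> 1" by (rule less_imp_le)
  have "cmod (?y$1) * (1 - (cmod z)\<^sup>2) < cmod (1 - x$2 * ?w + x$3 * ?w\<^sup>2)"
  proof (cases "x$1 = 0")
    case True
    then have "cmod (?y$1) * (1 - (cmod z)\<^sup>2) = 0" by (simp add: m_action_def)
    also have "0 < (1 - cmod ?w)\<^sup>2" using w1 by (intro zero_less_power) linarith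
    also note closure_pentablock(2)[OF x w1']
    finally show ?thesis .
  next
    case False
    define y where "y = (cmod z)\<^sup>2"
    have y: "0 \<le> y" "y \<le> 1" using z by (simp_all add: y_def power_le_one)
    have "c ^ k \<le> c ^ 1" by (rule power_decreasing) (use c k in auto)
    then have "c ^ k * (1 - y) \<le> c * (1 - y)" using y by (intro mult_right_mono) auto
    also have "c * (1 - y) < 1 - (c * cmod z)\<^sup>2"
    proof -
      have "0 < (1 - c) * (1 + c * y)" by (intro mult_pos_pos add_pos_nonneg mult_nonneg_nonneg) (use c y in auto)
      then show ?thesis by (simp add: y_def algebra_simps power2_eq_square)
    qed
    finally have "cmod (x$1) * (c ^ k * (1 - y)) < cmod (x$1) * (1 - (c * cmod z)\<^sup>2)"
      using False by (intro mult_strict_left_mono) auto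
    moreover have "cmod (?y$1) = cmod (x$1) * c ^ k"
      using c by (simp add: m_action_def norm_mult norm_power)
    ultimately have "cmod (?y$1) * (1 - (cmod z)\<^sup>2) < cmod (x$1) * (1 - (cmod ?w)\<^sup>2)"
      unfolding w y_def by (simp only: mult.assoc)
    also note closure_pentablock(1)[OF x w1']
    finally show ?thesis .
  qed
  also have "1 - x$2 * ?w + x$3 * ?w\<^sup>2 = 1 - ?y$2 * z + ?y$3 * z\<^sup>2"
    by (simp add: m_action_def power_mult_distrib mult_ac)
  finally show "cmod (?y$1) * (1 - (cmod z)\<^sup>2) < cmod (1 - ?y$2 * z + ?y$3 * z\<^sup>2)" .
qed

lemma zero_in_pentablock: "0 \<in> pentablock"
  unfolding pentablock_iff by simp

section \<open>The exhaustion function\<close>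

text \<open>Expanding squares, the difference is
  \<open>4 (1 - x\<^sup>2 q\<^sup>2) - 4 Re (z (s - cnj s * p)) - \<bar>s\<bar>\<^sup>2 (1 - x\<^sup>2)\<close> with \<open>x = \<bar>z\<bar>\<close> and \<open>q = \<bar>p\<bar>\<close>. Inserting the
  bounds for \<open>s - cnj s * p\<close> and \<open>s\<close> leaves a quadratic polynomial in \<open>x\<close> with roots \<open>1\<close> and
  \<open>(3 + q) / (1 + 3 q) > 1\<close>, hence positive for \<open>x < 1\<close>. For \<open>x = 1\<close> the strictness of the bound for
  \<open>s - cnj s * p\<close> decides.\<close>

lemma Phi_less_1:
  assumes G: "(s, p) \<in> sym_bidisc" and z: "cmod z \<le> 1"
  shows "cmod (2 * z * p - s) < cmod (2 - z * s)"
proof -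
  define q where "q = cmod p"
  define x where "x = cmod z"
  define m where "m = cmod (s - cnj s * p)"
  have q: "0 \<le> q" "q < 1" and m: "m < 1 - q\<^sup>2" and s: "cmod s < 1 + q"
    using sym_bidisc_bounds(1,2,3)[OF G] by (auto simp: q_def m_def)
  have x: "0 \<le> x" "x \<le> 1" using z by (auto simp: x_def)
  have id: "(cmod (2 - z * s))\<^sup>2 - (cmod (2 * z * p - s))\<^sup>2
     = 4 * (1 - x\<^sup>2 * q\<^sup>2) - 4 * Re (z * (s - cnj s * p)) - (cmod s)\<^sup>2 * (1 - x\<^sup>2)"
    unfolding x_def q_def cmod_power2 by (simp add: algebra_simps power2_eq_square)
  have re: "Re (z * (s - cnj s * p)) \<le> x * m"
    unfolding x_def m_def norm_mult[symmetric] by (rule complex_Re_le_cmod)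
  have x2: "0 \<le> 1 - x\<^sup>2" using x by (simp add: power_le_one)
  have "0 < 4 * (1 - x\<^sup>2 * q\<^sup>2) - 4 * (x * m) - (cmod s)\<^sup>2 * (1 - x\<^sup>2)"
  proof (cases "x = 1")
    case True
    then show ?thesis using m by simp
  next
    case False
    with x have x1: "x < 1" by simp
    define y where "y = (1 + 3 * q) * x"
    have "y \<le> 1 + 3 * q" unfolding y_def by (rule mult_left_le) (use q x in auto)
    then have "0 < (3 + q) - y" using q by linarith
    then have "0 < (3 + q) - (1 + 3 * q) * x" unfolding y_def .
    then have "0 < (1 - q) * (1 - x) * ((3 + q) - (1 + 3 * q) * x)"
      using q x1 by (intro mult_pos_pos) auto
    also have "\<dots> = 4 * (1 - x\<^sup>2 * q\<^sup>2) - 4 * (x * (1 - q\<^sup>2)) - (1 + q)\<^sup>2 * (1 - x\<^sup>2)"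
      by (simp add: algebra_simps power2_eq_square)
    also have "\<dots> \<le> 4 * (1 - x\<^sup>2 * q\<^sup>2) - 4 * (x * m) - (cmod s)\<^sup>2 * (1 - x\<^sup>2)"
    proof -
      have "x * m \<le> x * (1 - q\<^sup>2)" by (rule mult_left_mono) (use m x in auto)
      moreover have "(cmod s)\<^sup>2 * (1 - x\<^sup>2) \<le> (1 + q)\<^sup>2 * (1 - x\<^sup>2)"
        by (intro mult_right_mono power_mono) (use s x2 in auto)
      ultimately show ?thesis by linarith
    qed
    finally show ?thesis .
  qed
  with id re have "(cmod (2 * z * p - s))\<^sup>2 < (cmod (2 - z * s))\<^sup>2" by linarith
  then show ?thesis by (rule power2_less_imp_less) (rule norm_ge_zero)
qed

text \<open>Suppose a root \<open>u\<close> of \<open>X\<^sup>2 - s X + p\<close> is not in the open disc, and let \<open>v\<close> be the other one. At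
  \<open>z = 1 / u\<close> the hypothesis reads \<open>\<bar>v - u\<bar> \<le> t \<bar>v - u\<bar> / \<bar>u\<bar>\<close>, which forces \<open>u = v\<close>. The hypothesis at
  \<open>z = - 1 / u\<close> then reads \<open>4 \<bar>u\<bar> \<le> 4 t\<close>, a contradiction. The formulation without quotient makes
  the lemma applicable to boundary points, where \<open>2 - z s\<close> may vanish.\<close>

lemma sym_bidisc_if_Phi_le:
  assumes t: "t < 1" and le: "\<And>z. cmod z \<le> 1 \<Longrightarrow> cmod (2 * z * p - s) \<le> t * cmod (2 - z * s)"
  shows "(s, p) \<in> sym_bidisc"
proof -
  have "cmod s \<le> t * 2" using le[of 0] by simp
  then have t0: "0 \<le> t" using norm_ge_zero[of s] by linarith
  have root: "cmod u < 1" if uv: "s = u + v" "p = u * v" for u v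
  proof (rule ccontr)
    assume "\<not> cmod u < 1"
    then have u1: "1 \<le> cmod u" and u0: "u \<noteq> 0" by auto
    have z: "cmod (1 / u) \<le> 1" "cmod (- 1 / u) \<le> 1" using u1 by (auto simp: norm_divide divide_simps)
    have "2 * (1 / u) * p - s = v - u" "2 - 1 / u * s = - ((v - u) / u)"
      using u0 by (auto simp: uv field_simps)
    with le[OF z(1)] have "cmod (v - u) \<le> t * (cmod (v - u) / cmod u)"
      by (simp only: norm_divide norm_minus_cancel)
    also have "cmod (v - u) / cmod u \<le> cmod (v - u) / 1"
      by (rule divide_left_mono) (use u1 in auto)
    finally have "cmod (v - u) \<le> t * cmod (v - u)" using t0 by (simp add: mult_left_mono)
    then have "(1 - t) * cmod (v - u) \<le> 0" by (simp add: algebra_simps)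
    then have "v = u" using t by (simp add: mult_le_0_iff)
    then have "2 * (- 1 / u) * p - s = - 4 * u" "2 - - 1 / u * s = 4"
      using u0 by (auto simp: uv field_simps)
    with le[OF z(2)] have "cmod (- 4 * u) \<le> t * cmod 4" by (simp only:)
    then have "cmod u \<le> t" by (simp add: norm_mult)
    with t u1 show False by simp
  qed
  obtain u v where uv: "s = u + v" "p = u * v" by (rule obtain_roots)
  with root[of u v] root[of v u] show ?thesis
    using sym_bidisc_iff_roots[OF uv] by (simp add: add.commute mult.commute)
qed

definition Psi :: "complex \<Rightarrow> complex ^ 3 \<Rightarrow> complex" where
  "Psi z x = x$1 * of_real (1 - (cmod z)\<^sup>2) / (1 - x$2 * z + x$3 * z\<^sup>2)"

text \<open>As functions of \<open>(s, p)\<close> these map the symmetrized bidisc to the disc and at the diagonal points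
  \<open>(2 u, u\<^sup>2)\<close> take the value \<open>- u\<close>, independently of \<open>z\<close>.\<close>

definition Phi :: "complex \<Rightarrow> complex ^ 3 \<Rightarrow> complex" where
  "Phi z x = (2 * z * x$3 - x$2) / (2 - z * x$2)"

definition exhaustion :: "complex ^ 3 \<Rightarrow> real" where
  "exhaustion x = max (SUP z\<in>cball 0 1. cmod (Psi z x)) (SUP z\<in>cball 0 1. cmod (Phi z x)) - 1"

lemma Psi_denominator: "x \<in> pentablock \<Longrightarrow> cmod z \<le> 1 \<Longrightarrow> 1 - x$2 * z + x$3 * z\<^sup>2 \<noteq> 0"
  using pentablock_denominator_pos by fastforce

lemma Phi_denominator:
  assumes "x \<in> pentablock" "cmod z \<le> 1" shows "2 - z * x$2 \<noteq> 0"
  using Phi_less_1[OF pentablock_sym_bidisc[OF assms(1)] assms(2)]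
  by (metis norm_not_less_zero norm_zero)

lemma norm_Psi_less_1:
  assumes "x \<in> pentablock" "cmod z \<le> 1"
  shows "cmod (Psi z x) < 1"
proof -
  have "cmod (x$1 * of_real (1 - (cmod z)\<^sup>2)) = cmod (x$1) * (1 - (cmod z)\<^sup>2)"
    unfolding norm_mult norm_of_real using assms(2) by (simp add: power_le_one)
  also have "\<dots> < cmod (1 - x$2 * z + x$3 * z\<^sup>2)"
    using assms unfolding pentablock_iff by simp
  finally show ?thesis
    unfolding Psi_def norm_divide
    by (subst divide_less_eq_1_pos[OF pentablock_denominator_pos[OF assms]])
qed

lemma norm_Phi_less_1:
  assumes "x \<in> pentablock" "cmod z \<le> 1"
  shows "cmod (Phi z x) < 1"
proof -
  have "0 < cmod (2 - z * x$2)" using Phi_denominator[OF assms] by (simp only: zero_less_norm_iff not_False_eq_True)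
  then show ?thesis
    unfolding Phi_def norm_divide
    using Phi_less_1[OF pentablock_sym_bidisc[OF assms(1)] assms(2)] by (subst divide_less_eq_1_pos)
qed

lemma continuous_on_norm_Psi: "continuous_on (pentablock \<times> cball 0 1) (\<lambda>(x, z). cmod (Psi z x))"
  unfolding Psi_def case_prod_unfold
  by (intro continuous_intros ballI Psi_denominator) auto

lemma continuous_on_norm_Phi: "continuous_on (pentablock \<times> cball 0 1) (\<lambda>(x, z). cmod (Phi z x))"
  unfolding Phi_def case_prod_unfold
  by (intro continuous_intros ballI Phi_denominator) auto

lemmas SUP_Psi =
  continuous_on_SUP_compact[OF compact_cball _ continuous_on_norm_Psi, simplified]
lemmas SUP_Phi =
  continuous_on_SUP_compact[OF compact_cball _ continuous_on_norm_Phi, simplified]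

lemma norm_le_exhaustion:
  assumes "x \<in> pentablock" "cmod z \<le> 1"
  shows "cmod (Psi z x) \<le> exhaustion x + 1" "cmod (Phi z x) \<le> exhaustion x + 1"
proof -
  have "cmod (Psi z x) \<le> (SUP z\<in>cball 0 1. cmod (Psi z x))"
    by (rule cSUP_upper[OF _ SUP_Psi(2)]) (use assms in auto)
  then show "cmod (Psi z x) \<le> exhaustion x + 1" unfolding exhaustion_def by linarith
  have "cmod (Phi z x) \<le> (SUP z\<in>cball 0 1. cmod (Phi z x))"
    by (rule cSUP_upper[OF _ SUP_Phi(2)]) (use assms in auto)
  then show "cmod (Phi z x) \<le> exhaustion x + 1" unfolding exhaustion_def by linarith
qed

lemma exhaustion_attained:
  assumes "x \<in> pentablock"
  obtains z where "cmod z \<le> 1" "exhaustion x + 1 = cmod (Psi z x)"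
  | z where "cmod z \<le> 1" "exhaustion x + 1 = cmod (Phi z x)"
proof -
  obtain z where z: "cmod z \<le> 1" "(SUP z\<in>cball 0 1. cmod (Psi z x)) = cmod (Psi z x)"
    using SUP_Psi(3)[OF assms] by auto
  obtain z' where z': "cmod z' \<le> 1" "(SUP z\<in>cball 0 1. cmod (Phi z x)) = cmod (Phi z' x)"
    using SUP_Phi(3)[OF assms] by auto
  have "exhaustion x + 1 = cmod (Psi z x) \<or> exhaustion x + 1 = cmod (Phi z' x)"
    unfolding exhaustion_def z(2) z'(2) by linarith
  with z(1) z'(1) that show thesis by blast
qed

lemma continuous_on_exhaustion: "continuous_on pentablock exhaustion"
  unfolding exhaustion_def by (intro continuous_intros SUP_Psi(1) SUP_Phi(1))

lemma exhaustion_neg: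
  assumes "x \<in> pentablock" shows "exhaustion x < 0"
  using assms norm_Psi_less_1[OF assms] norm_Phi_less_1[OF assms] 
  by (cases rule: exhaustion_attained[OF assms]) force+

text \<open>Along a complex line, the member of the two families that attains the supremum at the centre
  is holomorphic in the line parameter and supports the exhaustion function from below.\<close>

lemma plurisubharmonic_exhaustion: "plurisubharmonic_on pentablock (\<lambda>x. ereal (exhaustion x))"
  unfolding plurisubharmonic_on_def
proof (intro conjI allI ballI)
  show "usc_on pentablock (\<lambda>x. ereal (exhaustion x))"
    by (rule usc_on_ereal[OF continuous_on_exhaustion])
  fix a b :: "complex ^ 3"
  let ?l = "\<lambda>w. a + w *s b" and ?U = "{w. a + w *s b \<in> pentablock}"
  show "subharmonic_on ?U (\<lambda>w. ereal (exhaustion (?l w)))"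
  proof (rule subharmonic_onI_support)
    have "continuous_on ?U ?l"
      unfolding vector_scalar_mult_def by (intro continuous_intros)
    then show "continuous_on ?U (\<lambda>w. exhaustion (?l w))"
      by (rule continuous_on_compose2[OF continuous_on_exhaustion]) auto
    fix c assume "c \<in> ?U"
    then have "?l c \<in> pentablock" by simp
    then show "\<exists>f. f holomorphic_on ?U \<and> (\<forall>w\<in>?U. cmod (f w) - 1 \<le> exhaustion (?l w))
        \<and> cmod (f c) - 1 = exhaustion (?l c)"
    proof (cases rule: exhaustion_attained)
      case (1 z)
      have "1 - (a$2 + w * b$2) * z + (a$3 + w * b$3) * z\<^sup>2 \<noteq> 0" if "w \<in> ?U" for w
        using Psi_denominator[of "?l w" z] that 1(1) by simp
      then have "(\<lambda>w. Psi z (?l w)) holomorphic_on ?U"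
        unfolding Psi_def vector_add_component vector_smult_component
        by (intro holomorphic_intros)
      moreover have "cmod (Psi z (?l w)) - 1 \<le> exhaustion (?l w)" if "w \<in> ?U" for w
        using norm_le_exhaustion(1)[of "?l w" z] that 1(1) by simp
      ultimately show ?thesis using 1(2) by (intro exI[of _ "\<lambda>w. Psi z (?l w)"]) simp
    next
      case (2 z)
      have "2 - z * (a$2 + w * b$2) \<noteq> 0" if "w \<in> ?U" for w
        using Phi_denominator[of "?l w" z] that 2(1) by simp
      then have "(\<lambda>w. Phi z (?l w)) holomorphic_on ?U"
        unfolding Phi_def vector_add_component vector_smult_component
        by (intro holomorphic_intros)
      moreover have "cmod (Phi z (?l w)) - 1 \<le> exhaustion (?l w)" if "w \<in> ?U" for w
        using norm_le_exhaustion(2)[of "?l w" z] that 2(1) by simp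
      ultimately show ?thesis using 2(2) by (intro exI[of _ "\<lambda>w. Phi z (?l w)"]) simp
    qed
  qed
qed simp

text \<open>On the sublevel set both families are bounded by \<open>t = c + 1 < 1\<close>. Cleared of denominators,
  these bounds hold on the closure; the second one puts \<open>(s, p)\<close> into the symmetrized bidisc, so that
  the denominator of \<open>Psi z\<close> is nonzero and the first one becomes strict without the factor \<open>t\<close>.\<close>

lemma closure_sublevel_exhaustion:
  assumes "c < 0"
  shows "closure {x \<in> pentablock. exhaustion x < c} \<subseteq> pentablock"
proof
  fix x assume x: "x \<in> closure {x \<in> pentablock. exhaustion x < c}"
  define t where "t = c + 1"
  have t: "t < 1" using assms by (simp add: t_def)
  have Psi: "cmod (x$1) * (1 - (cmod z)\<^sup>2) \<le> t * cmod (1 - x$2 * z + x$3 * z\<^sup>2)"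
    (is "?P x") if z: "cmod z \<le> 1" for z
  proof -
    have "closure {x \<in> pentablock. exhaustion x < c} \<subseteq> {x. ?P x}"
    proof (rule closure_minimal)
      show "{x \<in> pentablock. exhaustion x < c} \<subseteq> {x. ?P x}"
      proof safe
        fix y assume y: "y \<in> pentablock" "exhaustion y < c"
        have "cmod (y$1 * of_real (1 - (cmod z)\<^sup>2)) = cmod (y$1) * (1 - (cmod z)\<^sup>2)"
          unfolding norm_mult norm_of_real using z by (simp add: power_le_one)
        moreover have "cmod (Psi z y) \<le> t"
          using norm_le_exhaustion(1)[OF y(1) z] y(2) unfolding t_def by linarith
        ultimately show "?P y"
          unfolding Psi_def norm_divide pos_divide_le_eq[OF pentablock_denominator_pos[OF y(1) z]]
          by argo
      qed
    qed (intro closed_Collect_le continuous_intros)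
    with x show ?thesis by blast
  qed
  have Phi: "cmod (2 * z * x$3 - x$2) \<le> t * cmod (2 - z * x$2)"
    (is "?P x") if z: "cmod z \<le> 1" for z
  proof -
    have "closure {x \<in> pentablock. exhaustion x < c} \<subseteq> {x. ?P x}"
    proof (rule closure_minimal)
      show "{x \<in> pentablock. exhaustion x < c} \<subseteq> {x. ?P x}"
      proof safe
        fix y assume y: "y \<in> pentablock" "exhaustion y < c"
        have "0 < cmod (2 - z * y$2)"
          using Phi_denominator[OF y(1) z] unfolding zero_less_norm_iff .
        moreover have "cmod (Phi z y) \<le> t"
          using norm_le_exhaustion(2)[OF y(1) z] y(2) unfolding t_def by linarith
        ultimately show "?P y"
          unfolding Phi_def norm_divide by (simp only: pos_divide_le_eq)
      qed
    qed (intro closed_Collect_le continuous_intros)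
    with x show ?thesis by blast
  qed
  have G: "(x$2, x$3) \<in> sym_bidisc" by (rule sym_bidisc_if_Phi_le[OF t Phi])
  show "x \<in> pentablock"
    unfolding pentablock_iff
  proof
    fix z :: complex assume "z \<in> cball 0 1"
    then have z: "cmod z \<le> 1" by simp
    with G have "1 - x$2 * z + x$3 * z\<^sup>2 \<noteq> 0" by (simp add: sym_bidisc_def)
    then have "0 < cmod (1 - x$2 * z + x$3 * z\<^sup>2)" unfolding zero_less_norm_iff .
    from mult_strict_right_mono[OF t this] Psi[OF z]
    show "cmod (x$1) * (1 - (cmod z)\<^sup>2) < cmod (1 - x$2 * z + x$3 * z\<^sup>2)" by linarith
  qed
qed

theorem proposition5p2:
  fixes k :: nat
  assumes "k \<ge> 1"
  shows "continuous_on UNIV (m_minkowski (vector [k, 1, 2]) pentablock) \<and> hyperconvex pentablock"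
proof
  have m: "(vector [k, 1, 2] :: nat ^ 3) $ i \<ge> 1" for i
    using assms exhaust_3[of i] by auto
  show "continuous_on UNIV (m_minkowski (vector [k, 1, 2]) pentablock)"
    by (rule continuous_on_m_minkowski[OF open_pentablock m zero_in_pentablock])
      (rule pentablock_shrink[OF _ _ _ assms])
  have "connected pentablock"
    by (rule connected_if_shrinks_to_0[OF m])
      (rule pentablock_shrink[OF subsetD[OF closure_subset] _ _ assms])
  moreover have "compact (closure {x \<in> pentablock. exhaustion x < c})" for c
    unfolding compact_closure by (rule bounded_subset[OF bounded_pentablock]) blast
  ultimately show "hyperconvex pentablock"
    unfolding hyperconvex_def
    using zero_in_pentablock open_pentablock bounded_pentablock continuous_on_exhaustion
      exhaustion_neg plurisubharmonic_exhaustion closure_sublevel_exhaustion by blast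
qed

end
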